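(* Let $X$ be a functionally Hausdorff space. If the free Abelian paratopological group $AP(X)$ is of almost subcountable type, then $X$ is of countable pseudocharacter.
   Context: All spaces are assumed to be $T_0$. A paratopological group is a group with a topology such that multiplication is continuous. The (Markov) free Abelian paratopological group $AP(X)$ on a space $X$ is the Abelian paratopological group $G$ that contains $X$ as a subspace, is algebraically generated by $X$, and is such that every continuous map $f:X\to H$ to an Abelian paratopological group $H$ extends to a continuous homomorphism $\hat f:G\to H$; its underlying group is the free Abelian group on $X$. A space $X$ is functionally Hausdorff if for any two distinct points $x,y\in X$ there is a continuous $f:X\to\mathbb{R}$ with $f(x)\neq f(y)$. A space $Y$ is of almost subcountable type if it contains a non-empty compact set $K$ that is a $G_\delta$-set in $Y$ (an intersection of countably many open sets). A space $X$ is of countable pseudocharacter if every singleton $\{x\}$, $x\in X$, is a $G_\delta$-set in $X$. *)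

theory Defs
  imports "HOL-Analysis.Analysis" "HOL-Algebra.Free_Abelian_Groups"
begin

definition functionally_Hausdorff_space :: "'a topology \<Rightarrow> bool" where
  "functionally_Hausdorff_space X \<longleftrightarrow>
     (\<forall>x\<in>topspace X. \<forall>y\<in>topspace X. x \<noteq> y \<longrightarrow>
        (\<exists>f. continuous_map X euclideanreal f \<and> f x \<noteq> f y))"

definition almost_subcountable_type :: "'a topology \<Rightarrow> bool" where
  "almost_subcountable_type Y \<longleftrightarrow> (\<exists>K. K \<noteq> {} \<and> compactin Y K \<and> gdelta_in Y K)"

definition countable_pseudocharacter :: "'a topology \<Rightarrow> bool" where
  "countable_pseudocharacter X \<longleftrightarrow> (\<forall>x\<in>topspace X. gdelta_in X {x})"

(* The T0 clause renders the convention that all spaces are T0. *)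
definition abelian_paratopological_group :: "('g, 'm) monoid_scheme \<Rightarrow> 'g topology \<Rightarrow> bool" where
  "abelian_paratopological_group G T \<longleftrightarrow>
     comm_group G \<and> topspace T = carrier G \<and> t0_space T \<and>
     continuous_map (prod_topology T T) T (\<lambda>(x, y). x \<otimes>\<^bsub>G\<^esub> y)"

(* T is the topology of AP(X), whose underlying group is the free Abelian group on the points
   of X; a point x is identified with the generator frag_of x.  A definition cannot quantify
   over all types, so the universal property is stated for target groups carried by
   'a \<Rightarrow>\<^sub>0 int.  The subgroup generated by the image of X is a quotient of the free Abelian
   group on X, so this is no restriction: see free_Abelian_paratopology_universal below for
   targets of arbitrary type.  For every T0 space X exactly one such T exists
   (free_Abelian_paratopology_exists, free_Abelian_paratopology_unique). *)
definition free_Abelian_paratopology :: "'a topology \<Rightarrow> ('a \<Rightarrow>\<^sub>0 int) topology \<Rightarrow> bool" where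
  "free_Abelian_paratopology X T \<longleftrightarrow>
     abelian_paratopological_group (free_Abelian_group (topspace X)) T \<and>
     embedding_map X T frag_of \<and>
     (\<forall>(H :: ('a \<Rightarrow>\<^sub>0 int) monoid) S f.
        abelian_paratopological_group H S \<and> continuous_map X S f \<longrightarrow>
        (\<exists>h \<in> hom (free_Abelian_group (topspace X)) H.
           continuous_map T S h \<and> (\<forall>x\<in>topspace X. h (frag_of x) = f x)))"

theorem free_Abelian_paratopology_universal:
  fixes H :: "('b, 'm) monoid_scheme"
  assumes AP: "free_Abelian_paratopology X T"
    and H: "abelian_paratopological_group H S"
    and f: "continuous_map X S f"
  shows "\<exists>h \<in> hom (free_Abelian_group (topspace X)) H.
           continuous_map T S h \<and> (\<forall>x\<in>topspace X. h (frag_of x) = f x)"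
proof -
  let ?A = "free_Abelian_group (topspace X)"
  interpret H: comm_group H
    using H by (simp add: abelian_paratopological_group_def)
  have topS: "topspace S = carrier H" and S0: "t0_space S"
    and contS: "continuous_map (prod_topology S S) S (\<lambda>(x, y). x \<otimes>\<^bsub>H\<^esub> y)"
    using H by (auto simp: abelian_paratopological_group_def)
  have fim: "f ` topspace X \<subseteq> carrier H"
    using f topS by (metis continuous_map_image_subset_topspace)
  obtain p where p: "p \<in> hom ?A H" and pf: "\<And>x. x \<in> topspace X \<Longrightarrow> p (frag_of x) = f x"
    using H.free_Abelian_group_universal [OF fim] by blast
  interpret p: group_hom ?A H p
    by (simp add: group_hom_def group_hom_axioms_def p H.group_axioms)
  define I where "I = p ` carrier ?A"
  define s where "s = inv_into (carrier ?A) p"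
  define R where "R = s ` I"
  define M where "M = \<lparr>carrier = R, monoid.mult = (\<lambda>x y. s (p x \<otimes>\<^bsub>H\<^esub> p y)), one = s \<one>\<^bsub>H\<^esub>\<rparr>"
  define S' where "S' = pullback_topology R p S"
  have subI: "subgroup I H"
    unfolding I_def by (rule p.img_is_subgroup)
  have IH: "I \<subseteq> carrier H"
    using subI by (rule subgroup.subset)
  have ps: "p (s y) = y" if "y \<in> I" for y
    using that by (simp add: I_def s_def f_inv_into_f)
  have pR: "p x \<in> I" and sp: "s (p x) = x" if "x \<in> R" for x
    using that ps by (auto simp: R_def)
  have Imult: "x \<otimes>\<^bsub>H\<^esub> y \<in> I" if "x \<in> I" "y \<in> I" for x y
    using that subI by (simp add: subgroup.m_closed)
  have K: "comm_group (H\<lparr>carrier := I\<rparr>)"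
    by (rule group.group_comm_groupI [OF H.subgroup_imp_group [OF subI]])
      (use IH in \<open>auto intro: H.m_comm\<close>)
  have "s \<in> iso (H\<lparr>carrier := I\<rparr>) M"
    unfolding iso_def hom_def bij_betw_def inj_on_def M_def R_def
    by (auto simp: ps Imult) (metis ps)
  from comm_group.iso_imp_img_comm_group [OF K this]
  have M: "comm_group M"
    by (simp add: M_def)
  have topS': "topspace S' = R"
    using pR IH by (auto simp: S'_def topspace_pullback_topology topS)
  have contp: "continuous_map S' S p"
    using continuous_map_pullback [of S S id R p] by (simp add: S'_def)
  have "t0_space S'"
    unfolding t0_space_def
  proof (intro ballI impI)
    fix x y assume xy: "x \<in> topspace S'" "y \<in> topspace S'" "x \<noteq> y"
    then have "p x \<noteq> p y" "p x \<in> topspace S" "p y \<in> topspace S"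
      using sp pR IH by (metis topS', auto simp: topS topS')
    then obtain U where U: "openin S U" "(p x \<notin> U) = (p y \<in> U)"
      using S0 unfolding t0_space_def by metis
    have "openin S' (p -` U \<inter> R)"
      using U by (auto simp: S'_def openin_pullback_topology)
    then show "\<exists>U. openin S' U \<and> (x \<notin> U) = (y \<in> U)"
      using U xy topS' by blast
  qed
  moreover
  have "continuous_map (prod_topology S' S') S' (\<lambda>(x, y). s (p x \<otimes>\<^bsub>H\<^esub> p y))"
    unfolding S'_def
  proof (rule continuous_map_pullback', fold S'_def)
    have "continuous_map (prod_topology S' S') S
            ((\<lambda>(x, y). x \<otimes>\<^bsub>H\<^esub> y) \<circ> (\<lambda>(x, y). (p x, p y)))"
      by (rule continuous_map_compose [OF _ contS])
        (auto simp: continuous_map_prod_top contp)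
    then show "continuous_map (prod_topology S' S') S (p \<circ> (\<lambda>(x, y). s (p x \<otimes>\<^bsub>H\<^esub> p y)))"
      by (rule continuous_map_eq) (auto simp: topS' pR ps Imult)
    show "topspace (prod_topology S' S') \<subseteq> (\<lambda>(x, y). s (p x \<otimes>\<^bsub>H\<^esub> p y)) -` R"
      by (auto simp: topS' R_def ps Imult)
  qed
  ultimately have M': "abelian_paratopological_group M S'"
    using M topS' by (simp add: abelian_paratopological_group_def M_def)
  have fI: "f x \<in> I" if "x \<in> topspace X" for x
    unfolding I_def using pf [OF that] that
    by (metis frag_of_in_free_Abelian_group imageI)
  have "continuous_map X S' (s \<circ> f)"
    unfolding S'_def
  proof (rule continuous_map_pullback')
    show "continuous_map X S (p \<circ> (s \<circ> f))"
      by (rule continuous_map_eq [OF f]) (simp add: fI ps)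
    show "topspace X \<subseteq> (s \<circ> f) -` R"
      using fI by (auto simp: R_def)
  qed
  then obtain h where h: "h \<in> hom ?A M" "continuous_map T S' h"
      and hf: "\<And>x. x \<in> topspace X \<Longrightarrow> h (frag_of x) = s (f x)"
    using AP M' unfolding free_Abelian_paratopology_def by (metis comp_apply)
  have hR: "h u \<in> R" if "u \<in> carrier ?A" for u
    using hom_in_carrier [OF h(1) that] by (simp add: M_def)
  have "p \<circ> h \<in> hom ?A H"
  proof (rule homI)
    fix u v assume uv: "u \<in> carrier ?A" "v \<in> carrier ?A"
    show "(p \<circ> h) u \<in> carrier H"
      using hR [OF uv(1)] pR IH by auto
    have "h (u \<otimes>\<^bsub>?A\<^esub> v) = s (p (h u) \<otimes>\<^bsub>H\<^esub> p (h v))"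
      using hom_mult [OF h(1) uv] by (simp add: M_def)
    then show "(p \<circ> h) (u \<otimes>\<^bsub>?A\<^esub> v) = (p \<circ> h) u \<otimes>\<^bsub>H\<^esub> (p \<circ> h) v"
      using hR uv pR by (simp add: ps Imult)
  qed
  moreover have "continuous_map T S (p \<circ> h)"
    using h(2) contp by (rule continuous_map_compose)
  moreover have "\<forall>x\<in>topspace X. (p \<circ> h) (frag_of x) = f x"
    using hf fI ps by simp
  ultimately show ?thesis
    by blast
qed

lemma finite_t0_isolated_point:
  assumes X: "t0_space X" and F: "finite F" "F \<noteq> {}" "F \<subseteq> topspace X"
  obtains U x where "openin X U" "U \<inter> F = {x}"
proof -
  let ?P = "\<lambda>U. openin X U \<and> U \<inter> F \<noteq> {}"
  have "?P (topspace X)"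
    using F by auto
  then obtain U where U: "?P U" and min: "\<And>V. ?P V \<Longrightarrow> card (U \<inter> F) \<le> card (V \<inter> F)"
    by (metis ex_has_least_nat [of ?P _ "\<lambda>U. card (U \<inter> F)"])
  obtain x where x: "x \<in> U \<inter> F"
    using U by blast
  have "y = x" if y: "y \<in> U \<inter> F" for y
  proof (rule ccontr)
    assume "y \<noteq> x"
    then obtain V where V: "openin X V" "(x \<notin> V) = (y \<in> V)"
      using X F x y unfolding t0_space_def by (metis IntD2 subsetD)
    have "?P (U \<inter> V)"
      using U V x y by auto
    moreover have "card (U \<inter> V \<inter> F) < card (U \<inter> F)"
      using F V x y by (intro psubset_card_mono) auto
    ultimately show False
      using min [of "U \<inter> V"] by linarith
  qed
  with x U that show thesis
    by blast
qed

definition up_topology :: "int topology" where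
  "up_topology = topology (\<lambda>V. \<forall>a\<in>V. \<forall>b\<ge>a. b \<in> V)"

lemma openin_up_topology: "openin up_topology V \<longleftrightarrow> (\<forall>a\<in>V. \<forall>b\<ge>a. b \<in> V)"
proof -
  have "istopology (\<lambda>V::int set. \<forall>a\<in>V. \<forall>b\<ge>a. b \<in> V)"
    unfolding istopology_def by blast
  then show ?thesis
    by (simp add: up_topology_def)
qed

lemma topspace_up_topology [simp]: "topspace up_topology = UNIV"
  by (metis UNIV_I openin_subset openin_up_topology top.extremum_uniqueI)

lemma continuous_map_plus_up_topology:
  "continuous_map (prod_topology up_topology up_topology) up_topology (\<lambda>(x, y). x + y)"
  unfolding continuous_map_def
proof (intro conjI allI impI)
  fix V assume V: "openin up_topology V"
  show "openin (prod_topology up_topology up_topology)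
          {z \<in> topspace (prod_topology up_topology up_topology). (case z of (x, y) \<Rightarrow> x + y) \<in> V}"
    unfolding openin_prod_topology_alt
  proof (intro allI impI)
    fix a b
    assume ab: "(a, b) \<in> {z \<in> topspace (prod_topology up_topology up_topology).
                            (case z of (x, y) \<Rightarrow> x + y) \<in> V}"
    have "x + y \<in> V" if "a \<le> x" "b \<le> y" for x y
      using V ab that by (auto simp: openin_up_topology)
    moreover have "openin up_topology {a..}" "openin up_topology {b..}"
      by (auto simp: openin_up_topology)
    ultimately show "\<exists>U W. openin up_topology U \<and> openin up_topology W \<and> a \<in> U \<and> b \<in> W \<and>
        U \<times> W \<subseteq> {z \<in> topspace (prod_topology up_topology up_topology).
                            (case z of (x, y) \<Rightarrow> x + y) \<in> V}"
      by (intro exI [of _ "{a..}"] exI [of _ "{b..}"]) auto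
  qed
qed auto

lemma continuous_map_mult_pullback:
  assumes h: "h \<in> hom G H" and topS: "topspace S = carrier H"
    and G: "\<And>x y. x \<in> carrier G \<Longrightarrow> y \<in> carrier G \<Longrightarrow> x \<otimes>\<^bsub>G\<^esub> y \<in> carrier G"
    and contS: "continuous_map (prod_topology S S) S (\<lambda>(x, y). x \<otimes>\<^bsub>H\<^esub> y)"
  defines "T \<equiv> pullback_topology (carrier G) h S"
  shows "topspace T = carrier G"
    and "continuous_map (prod_topology T T) T (\<lambda>(x, y). x \<otimes>\<^bsub>G\<^esub> y)"
proof -
  show topT: "topspace T = carrier G"
    using hom_in_carrier [OF h] by (auto simp: T_def topspace_pullback_topology topS)
  have conth: "continuous_map T S h"
    using continuous_map_pullback [of S S id "carrier G" h] by (simp add: T_def)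
  show "continuous_map (prod_topology T T) T (\<lambda>(x, y). x \<otimes>\<^bsub>G\<^esub> y)"
    unfolding T_def
  proof (rule continuous_map_pullback', fold T_def)
    have "continuous_map (prod_topology T T) S
            ((\<lambda>(x, y). x \<otimes>\<^bsub>H\<^esub> y) \<circ> (\<lambda>(x, y). (h x, h y)))"
      by (rule continuous_map_compose [OF _ contS])
        (auto simp: continuous_map_prod_top conth)
    then show "continuous_map (prod_topology T T) S (h \<circ> (\<lambda>(x, y). x \<otimes>\<^bsub>G\<^esub> y))"
      by (rule continuous_map_eq) (auto simp: topT hom_mult [OF h])
    show "topspace (prod_topology T T) \<subseteq> (\<lambda>(x, y). x \<otimes>\<^bsub>G\<^esub> y) -` carrier G"
      by (auto simp: topT G)
  qed
qed

lemma pullback_paratopology: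
  fixes X :: "'a topology"
  defines "A \<equiv> free_Abelian_group (topspace X)"
  assumes h: "h \<in> hom A H" and S: "topspace S = carrier H"
    "continuous_map (prod_topology S S) S (\<lambda>(x, y). x \<otimes>\<^bsub>H\<^esub> y)"
    and X: "continuous_map X S (h \<circ> frag_of)"
  defines "T \<equiv> pullback_topology (carrier A) h S"
  shows "topspace T = carrier A \<and> continuous_map X T frag_of \<and>
      continuous_map (prod_topology T T) T (\<lambda>(x, y). x \<otimes>\<^bsub>A\<^esub> y)"
proof -
  interpret A: comm_group A
    unfolding A_def by (rule abelian_free_Abelian_group)
  have "continuous_map X T frag_of"
    unfolding T_def by (rule continuous_map_pullback' [OF X]) (auto simp: A_def)
  then show ?thesis
    using continuous_map_mult_pullback [OF h S(1) A.m_closed S(2)] by (simp add: T_def)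
qed

theorem free_Abelian_paratopology_exists:
  assumes X: "t0_space X"
  shows "\<exists>T. free_Abelian_paratopology X T"
proof -
  let ?A = "free_Abelian_group (topspace X)"
  interpret A: comm_group ?A
    by (rule abelian_free_Abelian_group)
  define P where "P = {T. topspace T = carrier ?A \<and> continuous_map X T frag_of \<and>
      continuous_map (prod_topology T T) T (\<lambda>(x, y). x \<otimes>\<^bsub>?A\<^esub> y)}"
  define T where "T = topology_generated_by {W. \<exists>T'\<in>P. openin T' W}"
  define ev where "ev U w = Poly_Mapping.lookup
      (frag_extend (\<lambda>x. if x \<in> U then frag_of () else 0) w) ()" for U and w :: "'a \<Rightarrow>\<^sub>0 int"
  have ev_frag: "ev U (frag_of x) = (if x \<in> U then 1 else 0)" for U x
    by (simp add: ev_def)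
  have ev_add: "ev U (v + w) = ev U v + ev U w" for U v w
    by (simp add: ev_def frag_extend_add lookup_add)
  have ev_diff: "ev U (v - w) = ev U v - ev U w" for U v w
    by (simp add: ev_def frag_extend_diff lookup_minus)
  have ev_pull: "pullback_topology (carrier ?A) (ev U) up_topology \<in> P" if U: "openin X U" for U
  proof -
    have "continuous_map X up_topology (ev U \<circ> frag_of)"
      unfolding continuous_map_def
    proof (intro conjI allI impI)
      fix V assume V: "openin up_topology V"
      have "{x \<in> topspace X. (ev U \<circ> frag_of) x \<in> V} =
          (if 0 \<in> V then topspace X else if 1 \<in> V then U else {})"
        using V openin_subset [OF U] by (auto simp: ev_frag openin_up_topology)
      then show "openin X {x \<in> topspace X. (ev U \<circ> frag_of) x \<in> V}"
        using U by simp
    qed auto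
    moreover have "ev U \<in> hom ?A integer_group"
      by (rule homI) (auto simp: ev_add)
    ultimately show ?thesis
      using continuous_map_plus_up_topology pullback_paratopology [of "ev U" X integer_group up_topology]
      by (simp add: P_def)
  qed
  have ev_open: "openin T {w \<in> carrier ?A. k \<le> ev U w}" if U: "openin X U" for U k
  proof -
    have "openin (pullback_topology (carrier ?A) (ev U) up_topology)
        {w \<in> carrier ?A. k \<le> ev U w}"
      unfolding openin_pullback_topology
      by (rule exI [of _ "{k..}"]) (auto simp: openin_up_topology)
    then show ?thesis
      using ev_pull [OF U] unfolding T_def by (blast intro: topology_generated_by_Basis)
  qed
  have finer: "openin T W" if "T' \<in> P" "openin T' W" for T' W
    using that unfolding T_def by (blast intro: topology_generated_by_Basis)
  have "\<exists>T'. T' \<in> P"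
    using ev_pull [OF openin_empty] by blast
  then have topT: "topspace T = carrier ?A"
    unfolding T_def topology_generated_by_topspace P_def
    by (auto dest: openin_subset)
  have idT: "continuous_map T T' id" if "T' \<in> P" for T'
  proof -
    have top: "topspace T' = topspace T"
      using that topT by (simp add: P_def)
    show ?thesis
      unfolding continuous_map_def
    proof (intro conjI allI impI)
      fix W assume W: "openin T' W"
      have "{w \<in> topspace T. id w \<in> W} = W"
        using openin_subset [OF W] by (auto simp: top)
      then show "openin T {w \<in> topspace T. id w \<in> W}"
        using finer [OF that W] by simp
    qed (simp add: top)
  qed
  have into_T: "continuous_map Z T g" if "\<And>T'. T' \<in> P \<Longrightarrow> continuous_map Z T' g"
    for Z :: "'z topology" and g
    unfolding T_def
  proof (rule continuous_on_generated_topo)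
    fix W assume "W \<in> {W. \<exists>T'\<in>P. openin T' W}"
    then obtain T' where "T' \<in> P" "openin T' W"
      by blast
    then show "openin Z (g -` W \<inter> topspace Z)"
      using that by (metis continuous_map_alt)
  next
    show "g ` topspace Z \<subseteq> \<Union> {W. \<exists>T'\<in>P. openin T' W}"
      using \<open>\<exists>T'. T' \<in> P\<close> that by (auto simp: continuous_map_def)
  qed
  have frag: "continuous_map X T frag_of"
    by (rule into_T) (simp add: P_def)
  have "continuous_map (prod_topology T T) T (\<lambda>(x, y). x \<otimes>\<^bsub>?A\<^esub> y)"
  proof (rule into_T)
    fix T' assume T': "T' \<in> P"
    have "continuous_map (prod_topology T T) (prod_topology T' T') (\<lambda>(x, y). (id x, id y))"
      using idT [OF T'] unfolding continuous_map_prod_top by blast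
    then have "continuous_map (prod_topology T T) (prod_topology T' T') id"
      by (simp add: id_def case_prod_beta')
    moreover have "continuous_map (prod_topology T' T') T' (\<lambda>(x, y). x \<otimes>\<^bsub>?A\<^esub> y)"
      using T' by (simp add: P_def)
    ultimately show "continuous_map (prod_topology T T) T' (\<lambda>(x, y). x \<otimes>\<^bsub>?A\<^esub> y)"
      by (metis continuous_map_compose comp_id)
  qed
  moreover have "t0_space T"
    unfolding t0_space_def topT
  proof (intro ballI impI)
    fix v w assume vw: "v \<in> carrier ?A" "w \<in> carrier ?A" "v \<noteq> w"
    have "Poly_Mapping.keys (v - w) \<subseteq> topspace X"
      using vw keys_diff [of v w] by auto
    moreover have "Poly_Mapping.keys (v - w) \<noteq> {}"
      using vw by simp
    ultimately obtain U x where U: "openin X U" "U \<inter> Poly_Mapping.keys (v - w) = {x}"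
      by (metis finite_t0_isolated_point [OF X finite_keys])
    have "ev U (v - w) = (\<Sum>i\<in>Poly_Mapping.keys (v - w).
        if i \<in> U then Poly_Mapping.lookup (v - w) i else 0)"
      unfolding ev_def frag_extend_def lookup_sum by (intro sum.cong) auto
    also have "\<dots> = (\<Sum>i\<in>U \<inter> Poly_Mapping.keys (v - w). Poly_Mapping.lookup (v - w) i)"
      by (simp add: sum.If_cases Int_commute)
    also have "\<dots> \<noteq> 0"
      using U(2) by (auto simp: in_keys_iff simp del: lookup_minus)
    finally have "ev U v \<noteq> ev U w"
      by (simp add: ev_diff)
    then consider "ev U v < ev U w" | "ev U w < ev U v"
      by linarith
    then show "\<exists>W. openin T W \<and> (v \<notin> W) = (w \<in> W)"
    proof cases
      case 1
      then show ?thesis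
        using vw by (intro exI [of _ "{u \<in> carrier ?A. ev U w \<le> ev U u}"])
          (auto simp: ev_open [OF U(1)] simp del: carrier_free_Abelian_group_iff)
    next
      case 2
      then show ?thesis
        using vw by (intro exI [of _ "{u \<in> carrier ?A. ev U v \<le> ev U u}"])
          (auto simp: ev_open [OF U(1)] simp del: carrier_free_Abelian_group_iff)
    qed
  qed
  ultimately have "abelian_paratopological_group ?A T"
    by (simp add: abelian_paratopological_group_def topT A.comm_group_axioms)
  moreover have "embedding_map X T frag_of"
    unfolding embedding_map_def
  proof (rule bijective_open_imp_homeomorphic_map)
    show "continuous_map X (subtopology T (frag_of ` topspace X)) frag_of"
      using frag by (auto simp: continuous_map_in_subtopology)
    show "open_map X (subtopology T (frag_of ` topspace X)) frag_of"
      unfolding open_map_def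
    proof (intro allI impI)
      fix U assume U: "openin X U"
      have "frag_of ` U = {w \<in> carrier ?A. 1 \<le> ev U w} \<inter> frag_of ` topspace X"
        using openin_subset [OF U] by (auto simp: ev_frag split: if_splits)
      then show "openin (subtopology T (frag_of ` topspace X)) (frag_of ` U)"
        unfolding openin_subtopology using ev_open [OF U] by blast
    qed
    show "frag_of ` topspace X = topspace (subtopology T (frag_of ` topspace X))"
      by (auto simp: topT)
    show "inj_on frag_of (topspace X)"
      by (auto simp: inj_on_def frag_of_eq)
  qed
  moreover have "\<exists>h \<in> hom ?A H. continuous_map T S h \<and> (\<forall>x\<in>topspace X. h (frag_of x) = f x)"
    if H: "abelian_paratopological_group H S" and f: "continuous_map X S f"
    for H :: "('a \<Rightarrow>\<^sub>0 int) monoid" and S f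
  proof -
    interpret H: comm_group H
      using H by (simp add: abelian_paratopological_group_def)
    have fim: "f ` topspace X \<subseteq> carrier H"
      using f H by (metis abelian_paratopological_group_def continuous_map_image_subset_topspace)
    obtain h where h: "h \<in> hom ?A H" and hf: "\<And>x. x \<in> topspace X \<Longrightarrow> h (frag_of x) = f x"
      using H.free_Abelian_group_universal [OF fim] by blast
    have "continuous_map X S (h \<circ> frag_of)"
      by (rule continuous_map_eq [OF f]) (simp add: hf)
    then have "pullback_topology (carrier ?A) h S \<in> P"
      using H pullback_paratopology [OF h, of S]
      by (simp add: P_def abelian_paratopological_group_def)
    from idT [OF this] have "continuous_map T S (id \<circ> h \<circ> id)"
      by (metis continuous_map_compose continuous_map_id continuous_map_pullback comp_assoc)
    then show ?thesis
      using h hf by auto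
  qed
  ultimately show ?thesis
    unfolding free_Abelian_paratopology_def by blast
qed

theorem free_Abelian_paratopology_unique:
  assumes T: "free_Abelian_paratopology X T" and T': "free_Abelian_paratopology X T'"
  shows "T = T'"
proof -
  let ?A = "free_Abelian_group (topspace X)"
  have finer: "openin T1 W"
    if T1: "free_Abelian_paratopology X T1" and T2: "free_Abelian_paratopology X T2"
      and W: "openin T2 W" for T1 T2 W
  proof -
    have A: "abelian_paratopological_group ?A T1" "abelian_paratopological_group ?A T2"
      using T1 T2 by (auto simp: free_Abelian_paratopology_def)
    then have top: "topspace T1 = carrier ?A" "topspace T2 = carrier ?A"
      by (auto simp: abelian_paratopological_group_def)
    have "continuous_map X T2 frag_of"
      using T2 unfolding free_Abelian_paratopology_def embedding_map_def
      by (metis continuous_map_in_subtopology homeomorphic_imp_continuous_map)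
    then obtain h where h: "h \<in> hom ?A ?A" "continuous_map T1 T2 h"
      and hx: "\<And>x. x \<in> topspace X \<Longrightarrow> h (frag_of x) = frag_of x"
      using free_Abelian_paratopology_universal [OF T1 A(2)] by blast
    have "h w = w" if "Poly_Mapping.keys w \<subseteq> topspace X" for w
    proof (rule free_Abelian_group_induct [OF that])
      show "h 0 = 0"
        using h(1) by (metis group_free_Abelian_group hom_one one_free_Abelian_group)
    next
      fix x y assume "Poly_Mapping.keys x \<subseteq> topspace X" "Poly_Mapping.keys y \<subseteq> topspace X"
        "h x = x" "h y = y"
      then show "h (x - y) = x - y"
        using hom_frag_diff [OF h(1)] by simp
    qed (rule hx)
    then have "{w \<in> topspace T1. h w \<in> W} = W"
      using openin_subset [OF W] unfolding top by force
    then show ?thesis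
      using openin_continuous_map_preimage [OF h(2) W] by simp
  qed
  show ?thesis
    unfolding topology_eq using finer T T' by blast
qed

end

theory Submission
  imports Defs
begin

text \<open>Translate the compact \<open>G\<^sub>\<delta>\<close>-set so that it contains the identity. Shrinking neighbourhoods of the
  identity inside it by \<open>W\<^sub>n\<^sub>+\<^sub>1 + W\<^sub>n\<^sub>+\<^sub>1 \<subseteq> W\<^sub>n\<close> yields a \<open>G\<^sub>\<delta>\<close>-subsemigroup \<open>H\<close> lying in a compact set.
  A continuous real homomorphism is bounded on that set, hence vanishes on \<open>H\<close>, which is closed under
  multiples. As \<open>X\<close> is functionally Hausdorff, such homomorphisms separate the points of \<open>AP(X)\<close>, so \<open>H\<close>
  is trivial and \<open>{0}\<close> is a \<open>G\<^sub>\<delta>\<close>-set; its translates restrict to the singletons of \<open>X\<close>.\<close>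

lemma gdelta_in_continuous_map_preimage:
  assumes f: "continuous_map X Y f" and S: "gdelta_in Y S"
  shows "gdelta_in X {x \<in> topspace X. f x \<in> S}"
proof -
  obtain C where C: "\<And>n. openin Y (C n)" "\<And>n::nat. C (Suc n) \<subseteq> C n" "\<Inter> (range C) = S"
    using S unfolding gdelta_in_descending by blast
  show ?thesis
    unfolding gdelta_in_descending
    using C openin_continuous_map_preimage [OF f]
    by (intro exI [of _ "\<lambda>n. {x \<in> topspace X. f x \<in> C n}"]) auto
qed

lemma continuous_map_translation:
  assumes G: "abelian_paratopological_group G T" and a: "a \<in> carrier G"
  shows "continuous_map T T (\<lambda>x. a \<otimes>\<^bsub>G\<^esub> x)"
proof -
  have "continuous_map T (prod_topology T T) (\<lambda>x. (a, x))"
    using a G by (auto simp: continuous_map_pairwise o_def abelian_paratopological_group_def)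
  moreover have "continuous_map (prod_topology T T) T (\<lambda>(x, y). x \<otimes>\<^bsub>G\<^esub> y)"
    using G by (simp add: abelian_paratopological_group_def)
  ultimately have "continuous_map T T ((\<lambda>(x, y). x \<otimes>\<^bsub>G\<^esub> y) \<circ> (\<lambda>x. (a, x)))"
    by (rule continuous_map_compose)
  then show ?thesis
    by (simp add: o_def)
qed

lemma neighbourhood_of_one_square:
  assumes G: "abelian_paratopological_group G T" and U: "openin T U" "\<one>\<^bsub>G\<^esub> \<in> U"
  obtains V where "openin T V" "\<one>\<^bsub>G\<^esub> \<in> V" "\<And>x y. x \<in> V \<Longrightarrow> y \<in> V \<Longrightarrow> x \<otimes>\<^bsub>G\<^esub> y \<in> U"
proof -
  interpret G: comm_group G
    using G by (simp add: abelian_paratopological_group_def)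
  let ?Q = "{z \<in> topspace (prod_topology T T). (case z of (x, y) \<Rightarrow> x \<otimes>\<^bsub>G\<^esub> y) \<in> U}"
  have "continuous_map (prod_topology T T) T (\<lambda>(x, y). x \<otimes>\<^bsub>G\<^esub> y)" and T: "topspace T = carrier G"
    using G by (auto simp: abelian_paratopological_group_def)
  from openin_continuous_map_preimage [OF this(1) U(1)] have "openin (prod_topology T T) ?Q" .
  moreover have "(\<one>\<^bsub>G\<^esub>, \<one>\<^bsub>G\<^esub>) \<in> ?Q"
    using U(2) T by simp
  ultimately obtain A B where AB: "openin T A" "openin T B" "\<one>\<^bsub>G\<^esub> \<in> A" "\<one>\<^bsub>G\<^esub> \<in> B" "A \<times> B \<subseteq> ?Q"
    unfolding openin_prod_topology_alt by meson
  have "x \<otimes>\<^bsub>G\<^esub> y \<in> U" if "x \<in> A \<inter> B" "y \<in> A \<inter> B" for x y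
    using subsetD [OF AB(5), of "(x, y)"] that by simp
  with AB that [of "A \<inter> B"] show thesis
    by blast
qed

text \<open>Compactness of \<open>K\<close> enters only through the boundedness of continuous real
  functions on it, which is why a supply of continuous additive functions, \<open>sep\<close>, is
  what the argument asks of the group.\<close>

lemma gdelta_in_one:
  assumes G: "abelian_paratopological_group G T"
    and K: "K \<noteq> {}" "compactin T K" "gdelta_in T K"
    and sep: "\<And>g. g \<in> carrier G \<Longrightarrow> g \<noteq> \<one>\<^bsub>G\<^esub> \<Longrightarrow>
      \<exists>\<phi>. continuous_map T euclideanreal \<phi> \<and> \<phi> g \<noteq> 0 \<and>
        (\<forall>x\<in>carrier G. \<forall>y\<in>carrier G. \<phi> (x \<otimes>\<^bsub>G\<^esub> y) = \<phi> x + \<phi> y)"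
  shows "gdelta_in T {\<one>\<^bsub>G\<^esub>}"
proof -
  interpret G: comm_group G
    using G by (simp add: abelian_paratopological_group_def)
  have T: "topspace T = carrier G"
    using G by (simp add: abelian_paratopological_group_def)
  obtain a where a: "a \<in> K" "a \<in> carrier G"
    using K T compactin_subset_topspace by blast
  \<comment> \<open>This is the translate of \<open>K\<close> by the inverse of \<open>a\<close>,
    written as a preimage under a continuous map; it contains the identity because \<open>a\<close>
    lies in \<open>K\<close>.\<close>
  have "gdelta_in T {x \<in> topspace T. a \<otimes>\<^bsub>G\<^esub> x \<in> K}"
    using continuous_map_translation [OF G a(2)] K(3) by (rule gdelta_in_continuous_map_preimage)
  then obtain U where U: "\<And>n. openin T (U n)" "\<And>n::nat. U (Suc n) \<subseteq> U n"
      and IU: "\<Inter> (range U) = {x \<in> topspace T. a \<otimes>\<^bsub>G\<^esub> x \<in> K}"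
    unfolding gdelta_in_descending by blast
  have "\<one>\<^bsub>G\<^esub> \<in> \<Inter> (range U)"
    using a T by (simp add: IU)
  then have one: "\<one>\<^bsub>G\<^esub> \<in> U n" for n
    by blast
  define P where "P n V \<longleftrightarrow> openin T V \<and> \<one>\<^bsub>G\<^esub> \<in> V \<and> V \<subseteq> U n" for n V
  have "\<exists>W. \<forall>n. P n (W n) \<and> (\<forall>x\<in>W (Suc n). \<forall>y\<in>W (Suc n). x \<otimes>\<^bsub>G\<^esub> y \<in> W n)"
  proof (rule dependent_nat_choice)
    show "\<exists>V. P 0 V"
      unfolding P_def using U(1) one by blast
    fix V n assume "P n V"
    then obtain V' where "openin T V'" "\<one>\<^bsub>G\<^esub> \<in> V'" "\<And>x y. x \<in> V' \<Longrightarrow> y \<in> V' \<Longrightarrow> x \<otimes>\<^bsub>G\<^esub> y \<in> V"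
      using neighbourhood_of_one_square [OF G, of V] unfolding P_def by blast
    then show "\<exists>V'. P (Suc n) V' \<and> (\<forall>x\<in>V'. \<forall>y\<in>V'. x \<otimes>\<^bsub>G\<^esub> y \<in> V)"
      unfolding P_def using U(1) one by (intro exI [of _ "V' \<inter> U (Suc n)"]) auto
  qed
  then obtain W where PW: "\<And>n. P n (W n)"
      and W_mult: "\<And>n x y. x \<in> W (Suc n) \<Longrightarrow> y \<in> W (Suc n) \<Longrightarrow> x \<otimes>\<^bsub>G\<^esub> y \<in> W n"
    by metis
  have W: "openin T (W n)" "\<one>\<^bsub>G\<^esub> \<in> W n" "W n \<subseteq> U n" for n
    using PW [of n] by (simp_all add: P_def)
  have WG: "W n \<subseteq> carrier G" for n
    using openin_subset [OF W(1)] T by simp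
  \<comment> \<open>Multiply by the identity, which lies in \<open>W (Suc n)\<close>.\<close>
  have "W (Suc n) \<subseteq> W n" for n
    using W_mult [OF _ W(2)] WG by fastforce
  then have gdelta: "gdelta_in T (\<Inter> (range W))"
    unfolding gdelta_in_descending using W(1) by blast
  have "h = \<one>\<^bsub>G\<^esub>" if h: "h \<in> \<Inter> (range W)" for h
  proof (rule ccontr)
    assume "h \<noteq> \<one>\<^bsub>G\<^esub>"
    have hG: "h \<in> carrier G"
      using h WG by blast
    obtain \<phi> where \<phi>: "continuous_map T euclideanreal \<phi>" "\<phi> h \<noteq> 0"
        and add: "\<And>x y. x \<in> carrier G \<Longrightarrow> y \<in> carrier G \<Longrightarrow> \<phi> (x \<otimes>\<^bsub>G\<^esub> y) = \<phi> x + \<phi> y"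
      using sep [OF hG \<open>h \<noteq> \<one>\<^bsub>G\<^esub>\<close>] by blast
    \<comment> \<open>The index \<open>n\<close> must stay general: to put the next power into
      \<open>W n\<close>, the current power and \<open>h\<close> are both needed in
      \<open>W (Suc n)\<close>.\<close>
    have pow_W: "h [^]\<^bsub>G\<^esub> k \<in> W n" for k n :: nat
      by (induction k arbitrary: n) (use W(2) W_mult h in auto)
    have pow: "\<phi> (a \<otimes>\<^bsub>G\<^esub> h [^]\<^bsub>G\<^esub> k) = \<phi> a + real k * \<phi> h" for k :: nat
    proof (induction k)
      case (Suc k)
      have "a \<otimes>\<^bsub>G\<^esub> h [^]\<^bsub>G\<^esub> Suc k = a \<otimes>\<^bsub>G\<^esub> h [^]\<^bsub>G\<^esub> k \<otimes>\<^bsub>G\<^esub> h"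
        using a hG by (simp add: G.m_assoc)
      then show ?case
        using a hG Suc by (simp add: add algebra_simps)
    qed (use a in simp)
    have in_K: "a \<otimes>\<^bsub>G\<^esub> h [^]\<^bsub>G\<^esub> k \<in> K" for k :: nat
    proof -
      have "h [^]\<^bsub>G\<^esub> k \<in> \<Inter> (range U)"
        using pow_W W(3) by blast
      then show ?thesis
        unfolding IU by simp
    qed
    have "compactin euclideanreal (\<phi> ` K)"
      using K(2) \<phi>(1) by (rule image_compactin)
    then obtain B where B: "\<And>x. x \<in> K \<Longrightarrow> \<bar>\<phi> x\<bar> \<le> B"
      using compact_imp_bounded by (force simp: bounded_iff)
    \<comment> \<open>The values of \<phi> at the points \<open>in_K\<close> form an arithmetic
      progression with nonzero step \<phi> h, so for this \<open>k\<close> the bound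
      \<open>B\<close> on \<open>K\<close> is exceeded.\<close>
    obtain k :: nat where k: "real k * \<bar>\<phi> h\<bar> > B + \<bar>\<phi> a\<bar>"
      using reals_Archimedean3 [of "\<bar>\<phi> h\<bar>"] \<phi>(2) by auto
    have "\<bar>\<phi> a + real k * \<phi> h\<bar> \<le> B"
      using B [OF in_K] by (simp add: pow)
    moreover have "\<bar>real k * \<phi> h\<bar> = real k * \<bar>\<phi> h\<bar>"
      by (simp add: abs_mult)
    ultimately show False
      using k by linarith
  qed
  then have "\<Inter> (range W) = {\<one>\<^bsub>G\<^esub>}"
    using W(2) by blast
  with gdelta show ?thesis
    by simp
qed

text \<open>Each point \<open>y\<close> of \<open>F\<close> has its own function \<open>g y\<close>
  separating it from \<open>x\<close>. The product over \<open>F\<close> of the differences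
  \<open>g y z - g y y\<close> vanishes at every point of \<open>F\<close>, while at
  \<open>x\<close> all its factors are nonzero.\<close>

lemma functionally_Hausdorff_isolate_in_finite:
  assumes X: "functionally_Hausdorff_space X" and F: "finite F" "F \<subseteq> topspace X"
    and x: "x \<in> topspace X" "x \<notin> F"
  obtains f where "continuous_map X euclideanreal f" "f x \<noteq> 0" "\<And>y. y \<in> F \<Longrightarrow> f y = 0"
proof -
  have "\<forall>y\<in>F. \<exists>g. continuous_map X euclideanreal g \<and> g y \<noteq> g x"
    using X F x unfolding functionally_Hausdorff_space_def by (metis subsetD)
  then obtain g where g: "\<And>y. y \<in> F \<Longrightarrow> continuous_map X euclideanreal (g y)"
      "\<And>y. y \<in> F \<Longrightarrow> g y y \<noteq> g y x"
    by metis
  show thesis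
  proof
    show "continuous_map X euclideanreal (\<lambda>z. \<Prod>y\<in>F. g y z - g y y)"
      using F(1) g(1) by (intro continuous_map_prod continuous_map_diff) auto
    show "(\<Prod>y\<in>F. g y x - g y y) \<noteq> 0"
      unfolding prod_zero_iff [OF F(1)] using g(2) by (metis eq_iff_diff_eq_0)
    show "(\<Prod>y\<in>F. g y z - g y y) = 0" if "z \<in> F" for z
      using F(1) that by force
  qed
qed

text \<open>As a target in the universal property, this group turns continuous real functions on the
  space into continuous real homomorphisms.\<close>

lemma additive_real_group:
  "abelian_paratopological_group \<lparr>carrier = UNIV, monoid.mult = (+), one = 0::real\<rparr> euclideanreal"
proof -
  have "comm_group \<lparr>carrier = UNIV, monoid.mult = (+), one = 0::real\<rparr>"
    by (rule comm_groupI) (auto intro: add.left_inverse)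
  moreover have "continuous_map euclidean euclideanreal (\<lambda>(x, y). x + y)"
    by (auto simp: case_prod_beta' intro!: continuous_intros)
  moreover have "t0_space euclideanreal"
    by (simp add: Hausdorff_imp_t1_space t1_imp_t0_space)
  ultimately show ?thesis
    by (simp add: abelian_paratopological_group_def)
qed

text \<open>Pick \<open>x\<close> in the support of \<open>g\<close> and a real function vanishing
  on the rest of the support but not at \<open>x\<close>. Its extension sends \<open>g\<close> to
  the nonzero coefficient of \<open>x\<close> times the nonzero value at \<open>x\<close>.\<close>

lemma free_Abelian_paratopology_separation:
  assumes X: "functionally_Hausdorff_space X" and T: "free_Abelian_paratopology X T"
    and g: "g \<in> carrier (free_Abelian_group (topspace X))" "g \<noteq> 0"
  obtains \<phi> where "continuous_map T euclideanreal \<phi>" "\<phi> g \<noteq> 0"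
    "\<And>x y. x \<in> carrier (free_Abelian_group (topspace X)) \<Longrightarrow>
      y \<in> carrier (free_Abelian_group (topspace X)) \<Longrightarrow> \<phi> (x + y) = \<phi> x + \<phi> y"
proof -
  let ?A = "free_Abelian_group (topspace X)"
  let ?F = "Poly_Mapping.keys g"
  have F: "?F \<subseteq> topspace X"
    using g(1) by simp
  obtain x where x: "x \<in> ?F"
    using g(2) by fastforce
  have "finite (?F - {x})" "?F - {x} \<subseteq> topspace X" "x \<in> topspace X" "x \<notin> ?F - {x}"
    using F x by auto
  from functionally_Hausdorff_isolate_in_finite [OF X this]
  obtain f where f: "continuous_map X euclideanreal f" "f x \<noteq> 0" "\<And>y. y \<in> ?F - {x} \<Longrightarrow> f y = 0"
    by blast
  \<comment> \<open>The target is carried by the reals, so the universal property for targets of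
    arbitrary type is required.\<close>
  from free_Abelian_paratopology_universal [OF T additive_real_group f(1)]
  obtain \<phi> where \<phi>: "\<phi> \<in> hom ?A \<lparr>carrier = UNIV, monoid.mult = (+), one = 0::real\<rparr>"
      "continuous_map T euclideanreal \<phi>" and \<phi>f: "\<And>y. y \<in> topspace X \<Longrightarrow> \<phi> (frag_of y) = f y"
    by blast
  have add: "\<phi> (u + v) = \<phi> u + \<phi> v" if "u \<in> carrier ?A" "v \<in> carrier ?A" for u v
    using hom_mult [OF \<phi>(1) that] by simp
  \<comment> \<open>The claim is limited to elements supported in the support of \<open>g\<close>,
    since \<open>f\<close> is not controlled elsewhere.\<close>
  have "\<phi> w = of_int (Poly_Mapping.lookup w x) * f x" if "Poly_Mapping.keys w \<subseteq> ?F" for w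
  proof (rule free_Abelian_group_induct [OF that])
    show "\<phi> 0 = of_int (Poly_Mapping.lookup 0 x) * f x"
      using add [of 0 0] by simp
  next
    fix u v assume uv: "Poly_Mapping.keys u \<subseteq> ?F" "Poly_Mapping.keys v \<subseteq> ?F"
      "\<phi> u = of_int (Poly_Mapping.lookup u x) * f x" "\<phi> v = of_int (Poly_Mapping.lookup v x) * f x"
    have "Poly_Mapping.keys (u - v) \<subseteq> ?F"
      using uv(1,2) keys_diff [of u v] by (meson Un_least order_trans)
    \<comment> \<open>The induction runs over differences, whereas \<open>add\<close> speaks of
      sums, so \<open>u\<close> is split as \<open>(u - v) + v\<close>.\<close>
    then have "\<phi> u = \<phi> (u - v) + \<phi> v"
      using add [of "u - v" v] uv F by auto
    then show "\<phi> (u - v) = of_int (Poly_Mapping.lookup (u - v) x) * f x"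
      using uv by (simp add: lookup_minus algebra_simps)
  next
    fix y assume "y \<in> ?F"
    then show "\<phi> (frag_of y) = of_int (Poly_Mapping.lookup (frag_of y) x) * f x"
      using F f(3) by (cases "y = x") (auto simp: \<phi>f)
  qed
  then have "\<phi> g \<noteq> 0"
    using x f(2) by (simp add: in_keys_iff)
  with \<phi>(2) add that show thesis
    by blast
qed

theorem theorem4p4:
  fixes X :: "'a topology" and T :: "('a \<Rightarrow>\<^sub>0 int) topology"
  assumes "functionally_Hausdorff_space X"
    and "free_Abelian_paratopology X T"
    and "almost_subcountable_type T"
  shows "countable_pseudocharacter X"
proof -
  let ?A = "free_Abelian_group (topspace X)"
  have A: "abelian_paratopological_group ?A T"
    using assms(2) by (simp add: free_Abelian_paratopology_def)
  obtain K where K: "K \<noteq> {}" "compactin T K" "gdelta_in T K"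
    using assms(3) unfolding almost_subcountable_type_def by blast
  have "gdelta_in T {\<one>\<^bsub>?A\<^esub>}"
  proof (rule gdelta_in_one [OF A K])
    fix g assume "g \<in> carrier ?A" "g \<noteq> \<one>\<^bsub>?A\<^esub>"
    then have "g \<noteq> 0"
      by simp
    from free_Abelian_paratopology_separation [OF assms(1,2) \<open>g \<in> carrier ?A\<close> this]
    show "\<exists>\<phi>. continuous_map T euclideanreal \<phi> \<and> \<phi> g \<noteq> 0 \<and>
        (\<forall>x\<in>carrier ?A. \<forall>y\<in>carrier ?A. \<phi> (x \<otimes>\<^bsub>?A\<^esub> y) = \<phi> x + \<phi> y)"
      unfolding mult_free_Abelian_group by metis
  qed
  then have zero: "gdelta_in T {0}"
    by simp
  have frag: "continuous_map X T frag_of"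
    using assms(2) unfolding free_Abelian_paratopology_def embedding_map_def
    by (metis continuous_map_in_subtopology homeomorphic_imp_continuous_map)
  have "gdelta_in X {x}" if x: "x \<in> topspace X" for x
  proof -
    \<comment> \<open>This translation moves the generator of \<open>x\<close> to 0. As distinct
      points have distinct generators, the preimage of \<open>{0}\<close> in the space is exactly
      \<open>{x}\<close>.\<close>
    have "continuous_map T T (\<lambda>v. - frag_of x + v)"
      using continuous_map_translation [OF A, of "- frag_of x"] x by simp
    from continuous_map_compose [OF frag this]
    have "gdelta_in X {y \<in> topspace X. ((\<lambda>v. - frag_of x + v) \<circ> frag_of) y \<in> {0}}"
      using zero by (rule gdelta_in_continuous_map_preimage)
    moreover have "{y \<in> topspace X. ((\<lambda>v. - frag_of x + v) \<circ> frag_of) y \<in> {0}} = {x}"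
      using x by (auto simp: frag_of_eq)
    ultimately show ?thesis
      by simp
  qed
  then show ?thesis
    by (simp add: countable_pseudocharacter_def)
qed

end
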